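(* Let $p\in(0,1)$, let $I\subseteq[0,\infty)$ be an interval containing $0$ and $1$, let $a,b\in I$ with $a<b$ and $a,b\in[c]_p$ for some $c\in I$, and let $\alpha,\beta\in\mathbb{R}$. Let $L:I\times\mathbb{R}^2\to\mathbb{R}$ be such that: (i) for every $t\in I$ the map $(u,v)\mapsto L(t,u,v)$ is in $C^1(\mathbb{R}^2,\mathbb{R})$; (ii) for every admissible function $y$ the map $t\mapsto L(t,y(t^p),D_p[y](t))$ is continuous at $1$; (iii) for every admissible function $y$ the maps $t\mapsto \partial_2L(t,y(t^p),D_p[y](t))$ and $t\mapsto\partial_3L(t,y(t^p),D_p[y](t))$ belong to $\mathcal{Y}([a,b]_p,\mathbb{R})$. Assume that $L(t,u,v)$ is jointly convex (resp. jointly concave) in $(u,v)$. If an admissible function $y_*$ satisfies the $p$-Euler-Lagrange equation $$\partial_2L\big(t,y_*(t^p),D_p[y_*](t)\big)=D_p\Big[\partial_3L\big(\cdot,y_*(\cdot^{\,p}),D_p[y_*](\cdot)\big)\Big](t)\qquad\text{for all }t\in[a,b]_p,$$ then $y_*$ is a global minimizer (resp. global maximizer) of $$\mathcal{L}[y]=\int_a^bL\big(t,y(t^p),D_p[y](t)\big)\,d_pt$$ among all $y\in\mathcal{Y}([a,b]_p,\mathbb{R})$ with $y(a)=\alpha$, $y(b)=\beta$; that is, $\mathcal{L}[y_*]\le\mathcal{L}[y]$ (resp. $\mathcal{L}[y_*]\ge\mathcal{L}[y]$) for every admissible function $y$.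
   Context: Fix $p\in(0,1)$. The $p$-derivative of $f$ is $D_pf(x)=D_p[f](x)=\frac{f(x^p)-f(x)}{x^p-x}$ for $x\neq0,1$, and $D_pf(0)=\lim_{x\to0^+}D_pf(x)$, $D_pf(1)=\lim_{x\to1}D_pf(x)$. For $t\ge0$, $[t]_p:=\{t^{p^j}:j\in\mathbb{N}_0\}\cup\{0,1\}$, and $[a,b]_p:=[a]_p\cup[b]_p$. $p$-integral (provided the series converge): for $0\le x<1$, $\int_0^xf(t)\,d_pt=\sum_{j=0}^\infty(x^{p^{-j}}-x^{p^{-j-1}})f(x^{p^{-j-1}})$; $\int_0^1f(t)\,d_pt=\sum_{j=-\infty}^\infty(p^{p^{j+1}}-p^{p^j})f(p^{p^j})$; for $0<x<1$, $\int_x^1f(t)\,d_pt=\sum_{j=0}^\infty(x^{p^{j+1}}-x^{p^j})f(x^{p^j})$; for $x>1$, $\int_1^xf(t)\,d_pt=\sum_{j=0}^\infty(x^{p^j}-x^{p^{j+1}})f(x^{p^j})$ and $\int_0^xf(t)\,d_pt=\int_0^1f(t)\,d_pt+\int_1^xf(t)\,d_pt$. For $1<a<b$, $\int_a^bf\,d_pt=\int_1^bf\,d_pt-\int_1^af\,d_pt$; for $0<a<b<1$ and for $0\le a<1<b$, $\int_a^bf\,d_pt=\int_0^bf\,d_pt-\int_0^af\,d_pt$. $\mathcal{Y}=\mathcal{Y}([a,b]_p,\mathbb{R})$ is the set of $y:I\to\mathbb{R}$ such that $y$ and $D_p[y]$ are bounded on $[a,b]_p$ and continuous at $0$ and $1$.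 An admissible function is $y\in\mathcal{Y}$ with $y(a)=\alpha$, $y(b)=\beta$. $\partial_jL$ is the partial derivative of $L$ with respect to its $j$th argument. $L(t,u,v)$ is jointly convex (resp. concave) in $(u,v)$ if $\partial_2L,\partial_3L$ exist and are continuous and $L(t,u+u_1,v+v_1)-L(t,u,v)\ge(\text{resp. }\le)\ \partial_2L(t,u,v)u_1+\partial_3L(t,u,v)v_1$ for all $(t,u,v),(t,u+u_1,v+v_1)\in I\times\mathbb{R}^2$.
   Formalization: For a = 0 the p-Euler-Lagrange equation is also required at the points of (0,1) where the p-integral from 0 to b samples its integrand (without this the claim is false); the p-integrals for y_* and for each compared y are assumed to converge. *)

theory Defs
  imports "HOL-Analysis.Analysis"
begin

definition p_node :: "real \<Rightarrow> real \<Rightarrow> int \<Rightarrow> real" where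
  "p_node p x j = x powr (p powi j)"

(* [t]_p; note [0]_p = [1]_p = {0,1} *)
definition p_orbit :: "real \<Rightarrow> real \<Rightarrow> real set" where
  "p_orbit p t = range (\<lambda>j::nat. p_node p t (int j)) \<union> {0, 1}"

definition p_lattice :: "real \<Rightarrow> real \<Rightarrow> real \<Rightarrow> real set" where
  "p_lattice p a b = p_orbit p a \<union> p_orbit p b"

(* A function I -> R is rendered as a function of type real => real of which only the values
   on I matter; accordingly limits and continuity at 0 and 1 are taken within I.  Since I is
   contained in [0,\<infinity>), the limit at 0 is the right-hand one.  Lim is unspecified when
   the limit does not exist, but continuity of p_deriv p I f at 0 (resp. 1) within I, as
   required in p_space, already forces the limit of the difference quotients to exist. *)
definition p_deriv :: "real \<Rightarrow> real set \<Rightarrow> (real \<Rightarrow> real) \<Rightarrow> real \<Rightarrow> real" where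
  "p_deriv p I f x =
     (if x = 0 \<or> x = 1
      then Lim (at x within I) (\<lambda>t. (f (t powr p) - f t) / (t powr p - t))
      else (f (x powr p) - f x) / (x powr p - x))"

(* has_p_integral p f a b s: all series defining the p-integral of f from a to b converge,
   and its value is s.  A bilateral series converges when both of its halves do.
   With x = 0 the first clause gives the integral from 0 to 0 the value 0. *)
inductive has_p_integral ::
  "real \<Rightarrow> (real \<Rightarrow> real) \<Rightarrow> real \<Rightarrow> real \<Rightarrow> real \<Rightarrow> bool" for p f where
  zero_below_one:
    "\<lbrakk>0 \<le> x; x < 1;
      (\<lambda>j::nat. (p_node p x (- int j) - p_node p x (- int j - 1)) * f (p_node p x (- int j - 1)))
        sums s\<rbrakk>
     \<Longrightarrow> has_p_integral p f 0 x s"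
| zero_one:
    "\<lbrakk>(\<lambda>j::nat. (p_node p p (int j + 1) - p_node p p (int j)) * f (p_node p p (int j))) sums s;
      (\<lambda>j::nat. (p_node p p (- int j) - p_node p p (- int j - 1)) * f (p_node p p (- int j - 1)))
        sums s'\<rbrakk>
     \<Longrightarrow> has_p_integral p f 0 1 (s + s')"
| to_one:
    "\<lbrakk>0 < x; x < 1;
      (\<lambda>j::nat. (p_node p x (int j + 1) - p_node p x (int j)) * f (p_node p x (int j))) sums s\<rbrakk>
     \<Longrightarrow> has_p_integral p f x 1 s"
| from_one:
    "\<lbrakk>1 < x;
      (\<lambda>j::nat. (p_node p x (int j) - p_node p x (int j + 1)) * f (p_node p x (int j))) sums s\<rbrakk>
     \<Longrightarrow> has_p_integral p f 1 x s"
| zero_above_one: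
    "\<lbrakk>1 < x; has_p_integral p f 0 1 s; has_p_integral p f 1 x s'\<rbrakk>
     \<Longrightarrow> has_p_integral p f 0 x (s + s')"
| above_one:
    "\<lbrakk>1 < a; a < b; has_p_integral p f 1 b s; has_p_integral p f 1 a s'\<rbrakk>
     \<Longrightarrow> has_p_integral p f a b (s - s')"
| below_one:
    "\<lbrakk>0 < a; a < b; b < 1; has_p_integral p f 0 b s; has_p_integral p f 0 a s'\<rbrakk>
     \<Longrightarrow> has_p_integral p f a b (s - s')"
| across_one:
    "\<lbrakk>0 < a; a < 1; 1 < b; has_p_integral p f 0 b s; has_p_integral p f 0 a s'\<rbrakk>
     \<Longrightarrow> has_p_integral p f a b (s - s')"

definition p_integrable :: "real \<Rightarrow> real \<Rightarrow> real \<Rightarrow> (real \<Rightarrow> real) \<Rightarrow> bool" where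
  "p_integrable p a b f \<longleftrightarrow> (\<exists>s. has_p_integral p f a b s)"

definition p_integral :: "real \<Rightarrow> real \<Rightarrow> real \<Rightarrow> (real \<Rightarrow> real) \<Rightarrow> real" where
  "p_integral p a b f = (THE s. has_p_integral p f a b s)"

definition p_space :: "real \<Rightarrow> real set \<Rightarrow> real \<Rightarrow> real \<Rightarrow> (real \<Rightarrow> real) set" where
  "p_space p I a b =
     {y. bounded (y ` p_lattice p a b) \<and>
         bounded (p_deriv p I y ` p_lattice p a b) \<and>
         (\<forall>x\<in>{0, 1}. continuous (at x within I) y \<and> continuous (at x within I) (p_deriv p I y))}"

definition p_admissible ::
  "real \<Rightarrow> real set \<Rightarrow> real \<Rightarrow> real \<Rightarrow> real \<Rightarrow> real \<Rightarrow> (real \<Rightarrow> real) set" where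
  "p_admissible p I a b \<alpha> \<beta> = {y \<in> p_space p I a b. y a = \<alpha> \<and> y b = \<beta>}"

definition partial2 :: "(real \<Rightarrow> real \<Rightarrow> real \<Rightarrow> real) \<Rightarrow> real \<Rightarrow> real \<Rightarrow> real \<Rightarrow> real" where
  "partial2 L t u v = deriv (\<lambda>u'. L t u' v) u"

definition partial3 :: "(real \<Rightarrow> real \<Rightarrow> real \<Rightarrow> real) \<Rightarrow> real \<Rightarrow> real \<Rightarrow> real \<Rightarrow> real" where
  "partial3 L t u v = deriv (\<lambda>v'. L t u v') v"

(* (u,v) \<mapsto> L(t,u,v) is C^1 on R^2: both partial derivatives exist everywhere and are
   jointly continuous in (u,v). *)
definition C1_in_uv :: "(real \<Rightarrow> real \<Rightarrow> real \<Rightarrow> real) \<Rightarrow> real \<Rightarrow> bool" where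
  "C1_in_uv L t \<longleftrightarrow>
     (\<forall>u v. (\<lambda>u'. L t u' v) field_differentiable (at u) \<and>
            (\<lambda>v'. L t u v') field_differentiable (at v)) \<and>
     continuous_on UNIV (\<lambda>(u, v). partial2 L t u v) \<and>
     continuous_on UNIV (\<lambda>(u, v). partial3 L t u v)"

definition jointly_convex :: "real set \<Rightarrow> (real \<Rightarrow> real \<Rightarrow> real \<Rightarrow> real) \<Rightarrow> bool" where
  "jointly_convex I L \<longleftrightarrow>
     (\<forall>t\<in>I. C1_in_uv L t \<and>
       (\<forall>u v u1 v1. L t (u + u1) (v + v1) - L t u v
          \<ge> partial2 L t u v * u1 + partial3 L t u v * v1))"

definition jointly_concave :: "real set \<Rightarrow> (real \<Rightarrow> real \<Rightarrow> real \<Rightarrow> real) \<Rightarrow> bool" where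
  "jointly_concave I L \<longleftrightarrow>
     (\<forall>t\<in>I. C1_in_uv L t \<and>
       (\<forall>u v u1 v1. L t (u + u1) (v + v1) - L t u v
          \<le> partial2 L t u v * u1 + partial3 L t u v * v1))"

(* For F = L, partial2 L, partial3 L: the map t \<mapsto> F(t, y(t^p), D_p[y](t)) *)
definition p_along ::
  "real \<Rightarrow> real set \<Rightarrow> (real \<Rightarrow> real \<Rightarrow> real \<Rightarrow> real) \<Rightarrow> (real \<Rightarrow> real) \<Rightarrow> real \<Rightarrow> real" where
  "p_along p I F y t = F t (y (t powr p)) (p_deriv p I y t)"

definition p_functional ::
  "real \<Rightarrow> real set \<Rightarrow> real \<Rightarrow> real \<Rightarrow> (real \<Rightarrow> real \<Rightarrow> real \<Rightarrow> real) \<Rightarrow> (real \<Rightarrow> real) \<Rightarrow> real"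
  where
  "p_functional p I a b L y = p_integral p a b (p_along p I L y)"

definition p_euler_lagrange_at ::
  "real \<Rightarrow> real set \<Rightarrow> (real \<Rightarrow> real \<Rightarrow> real \<Rightarrow> real) \<Rightarrow> (real \<Rightarrow> real) \<Rightarrow> real \<Rightarrow> bool" where
  "p_euler_lagrange_at p I L y t \<longleftrightarrow>
     p_along p I (partial2 L) y t = p_deriv p I (p_along p I (partial3 L) y) t"

(* The points of (0,1) at which the p-integral from 0 to b evaluates its integrand.  They do
   not belong to [0,b]_p, whose points other than 0 lie between b and 1: for instance
   [0,1]_p = {0,1}.  For a = 0 the Euler-Lagrange equation on [a,b]_p alone is therefore not
   sufficient for optimality and has to be supplemented at these points; for a > 0 the
   integrand is, after cancellation, only evaluated at points of [a,b]_p. *)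
definition p_origin_nodes :: "real \<Rightarrow> real \<Rightarrow> real set" where
  "p_origin_nodes p b =
     (if b < 1 then range (\<lambda>j::nat. p_node p b (- int j - 1)) else range (p_node p p))"

end

theory Submission
  imports Defs
begin

text \<open>
  The optimality of an extremal follows from a one-sided fundamental theorem of the
  \<open>p\<close>-calculus.  Between a node \<open>q\<close> and the next node \<open>q\<^sup>p\<close> the \<open>p\<close>-integral has the weight
  \<open>q\<^sup>p - q\<close> (its negative above 1), the very denominator of \<open>D\<^sub>p\<close>.  Hence, if
  \<open>D\<^sub>p G \<le> h\<close> at the nodes, every term of the series for the integral of \<open>h\<close> dominates an
  increment of \<open>G\<close>; the increments telescope, and continuity of \<open>G\<close> at 0 and 1 identifies
  the limits, so that the integral of \<open>h\<close> from \<open>a\<close> to \<open>b\<close> is at least \<open>G b - G a\<close>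
  (\<open>p_integral_ge_of_p_deriv_le\<close>).

  Let \<open>y\<^sub>*\<close> solve the Euler-Lagrange equation, let \<open>f\<close> and \<open>g\<close> be \<open>\<partial>\<^sub>2L\<close> and \<open>\<partial>\<^sub>3L\<close> along
  \<open>y\<^sub>*\<close>, and put \<open>\<eta> = y - y\<^sub>*\<close> for an admissible \<open>y\<close>.  Convexity bounds the difference of
  the two integrands at \<open>t\<close> below by \<open>f t * \<eta> (t\<^sup>p) + g t * D\<^sub>p \<eta> t\<close>.  Since \<open>f = D\<^sub>p g\<close>, the
  \<open>p\<close>-Leibniz rule (\<open>p_deriv_mult\<close>) turns this bound into \<open>D\<^sub>p (g * \<eta>)\<close>, and
  \<open>g * \<eta>\<close> vanishes at \<open>a\<close> and \<open>b\<close>.  Therefore the difference of the integrals is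
  nonnegative (\<open>p_integral_variation_nonneg\<close>).  In the concave case the same argument
  runs with the roles of \<open>y\<close> and \<open>y\<^sub>*\<close> in \<open>\<eta>\<close> exchanged.
\<close>

section \<open>Nodes\<close>

lemma p_node_succ: "0 < p \<Longrightarrow> p_node p x (j + 1) = p_node p x j powr p"
  by (simp add: p_node_def power_int_add_1 powr_powr)

lemma p_node_0: "0 < x \<Longrightarrow> p_node p x 0 = x"
  by (simp add: p_node_def)

lemma p_node_p_node: "0 < p \<Longrightarrow> p_node p (p_node p x i) j = p_node p x (i + j)"
  by (simp add: p_node_def power_int_add powr_powr)

lemma p_node_below_one: "0 < p \<Longrightarrow> 0 < x \<Longrightarrow> x < 1 \<Longrightarrow> 0 < p_node p x j \<and> p_node p x j < 1"
  using powr_less_mono2[of "p powi j" x 1] by (simp add: p_node_def)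

lemma p_node_above_one: "0 < p \<Longrightarrow> 1 < x \<Longrightarrow> 1 < p_node p x j"
  using powr_less_mono2[of "p powi j" 1 x] by (simp add: p_node_def)

lemma p_node_le_above_one:
  assumes "0 < p" "p < 1" "1 < x"
  shows "p_node p x (int j) \<le> x"
proof -
  have "p ^ j \<le> 1"
    using assms by (simp add: power_le_one)
  then show ?thesis
    using powr_mono[of "p ^ j" 1 x] assms by (simp add: p_node_def)
qed

lemma p_node_ge_below_one:
  assumes "0 < p" "p < 1" "0 < x" "x < 1"
  shows "x \<le> p_node p x (int j)"
proof -
  have "p ^ j \<le> 1"
    using assms by (simp add: power_le_one)
  then show ?thesis
    using powr_mono'[of "p ^ j" 1 x] assms by (simp add: p_node_def)
qed

lemma p_node_tendsto_one:
  assumes "0 < p" "p < 1" "0 < x"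
  shows "(\<lambda>j. p_node p x (int j)) \<longlonglongrightarrow> 1"
proof -
  have "(\<lambda>j. x powr (p ^ j)) \<longlonglongrightarrow> x powr 0"
    using assms by (intro tendsto_powr tendsto_const LIMSEQ_power_zero) auto
  then show ?thesis
    using assms by (simp add: p_node_def)
qed

lemma p_node_tendsto_zero:
  assumes "0 < p" "p < 1" "0 < x" "x < 1"
  shows "(\<lambda>j. p_node p x (- int j)) \<longlonglongrightarrow> 0"
proof -
  have "filterlim (\<lambda>j. inverse (p ^ j)) at_top sequentially"
    using assms by (intro filterlim_inverse_at_top LIMSEQ_power_zero) auto
  then have "filterlim (\<lambda>j. ln x * inverse (p ^ j)) at_bot sequentially"
    using assms by (intro filterlim_tendsto_neg_mult_at_bot[OF tendsto_const]) auto
  then have "(\<lambda>j. exp (ln x * inverse (p ^ j))) \<longlonglongrightarrow> 0"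
    by (rule filterlim_compose[OF exp_at_bot])
  then show ?thesis
    using assms by (simp add: p_node_def powr_def power_int_minus mult.commute)
qed

section \<open>Uniqueness and additivity of the p-integral\<close>

lemma has_p_integral_zero_below_oneD:
  assumes "has_p_integral p f 0 x s" "x < 1"
  shows "(\<lambda>j::nat. (p_node p x (- int j) - p_node p x (- int j - 1)) * f (p_node p x (- int j - 1)))
           sums s"
  using assms by (cases rule: has_p_integral.cases) auto

lemma has_p_integral_zero_oneD:
  assumes "has_p_integral p f 0 1 s"
  obtains s1 s2 where "s = s1 + s2"
    "(\<lambda>j::nat. (p_node p p (int j + 1) - p_node p p (int j)) * f (p_node p p (int j))) sums s1"
    "(\<lambda>j::nat. (p_node p p (- int j) - p_node p p (- int j - 1)) * f (p_node p p (- int j - 1)))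
        sums s2"
  using assms by (cases rule: has_p_integral.cases) auto

lemma has_p_integral_to_oneD:
  assumes "has_p_integral p f x 1 s" "0 < x"
  shows "(\<lambda>j::nat. (p_node p x (int j + 1) - p_node p x (int j)) * f (p_node p x (int j))) sums s"
  using assms by (cases rule: has_p_integral.cases) auto

lemma has_p_integral_from_oneD:
  assumes "has_p_integral p f 1 x s"
  shows "(\<lambda>j::nat. (p_node p x (int j) - p_node p x (int j + 1)) * f (p_node p x (int j))) sums s"
  using assms by (cases rule: has_p_integral.cases) auto

lemma has_p_integral_zero_above_oneD:
  assumes "has_p_integral p f 0 x s" "1 < x"
  obtains s1 s2 where "s = s1 + s2" "has_p_integral p f 0 1 s1" "has_p_integral p f 1 x s2"
  using assms by (cases rule: has_p_integral.cases) auto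

lemma has_p_integral_above_oneD:
  assumes "has_p_integral p f a b s" "1 < a"
  obtains s1 s2 where "s = s1 - s2" "has_p_integral p f 1 b s1" "has_p_integral p f 1 a s2"
  using assms by (cases rule: has_p_integral.cases) auto

lemma has_p_integral_from_below_oneD:
  assumes "has_p_integral p f a b s" "0 < a" "a < 1" "b \<noteq> 1"
  obtains s1 s2 where "s = s1 - s2" "has_p_integral p f 0 b s1" "has_p_integral p f 0 a s2"
  using assms by (cases rule: has_p_integral.cases) auto

lemma has_p_integral_diff:
  assumes "has_p_integral p f a b s" "has_p_integral p g a b s'"
  shows "has_p_integral p (\<lambda>t. f t - g t) a b (s - s')"
  using assms
proof (induction arbitrary: s' rule: has_p_integral.induct)
  case (zero_below_one x s)
  from sums_diff[OF zero_below_one(3) has_p_integral_zero_below_oneD[OF zero_below_one(4,2)]]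
  show ?case
    using zero_below_one(1,2) by (intro has_p_integral.zero_below_one) (simp_all add: right_diff_distrib)
next
  case (zero_one s t)
  obtain s1 t1 where *: "s' = s1 + t1"
    "(\<lambda>j::nat. (p_node p p (int j + 1) - p_node p p (int j)) * g (p_node p p (int j))) sums s1"
    "(\<lambda>j::nat. (p_node p p (- int j) - p_node p p (- int j - 1)) * g (p_node p p (- int j - 1)))
        sums t1"
    by (rule has_p_integral_zero_oneD[OF zero_one(3)])
  have "has_p_integral p (\<lambda>t. f t - g t) 0 1 ((s - s1) + (t - t1))"
    using sums_diff[OF zero_one(1) *(2)] sums_diff[OF zero_one(2) *(3)]
    by (intro has_p_integral.zero_one) (simp_all add: right_diff_distrib)
  then show ?case
    using *(1) by (simp add: algebra_simps)
next
  case (to_one x s)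
  from sums_diff[OF to_one(3) has_p_integral_to_oneD[OF to_one(4,1)]]
  show ?case
    using to_one(1,2) by (intro has_p_integral.to_one) (simp_all add: right_diff_distrib)
next
  case (from_one x s)
  from sums_diff[OF from_one(2) has_p_integral_from_oneD[OF from_one(3)]]
  show ?case
    using from_one(1) by (intro has_p_integral.from_one) (simp_all add: right_diff_distrib)
next
  case (zero_above_one x s t)
  obtain s1 t1 where *: "s' = s1 + t1" "has_p_integral p g 0 1 s1" "has_p_integral p g 1 x t1"
    by (rule has_p_integral_zero_above_oneD[OF zero_above_one(6,1)])
  from has_p_integral.zero_above_one[OF zero_above_one(1) zero_above_one(4)[OF *(2)]
      zero_above_one(5)[OF *(3)]]
  show ?case
    using *(1) by (simp add: algebra_simps)
next
  case (above_one a b s t)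
  obtain s1 t1 where *: "s' = s1 - t1" "has_p_integral p g 1 b s1" "has_p_integral p g 1 a t1"
    by (rule has_p_integral_above_oneD[OF above_one(7,1)])
  from has_p_integral.above_one[OF above_one(1,2) above_one(5)[OF *(2)] above_one(6)[OF *(3)]]
  moreover have "(s - s1) - (t - t1) = (s - t) - s'"
    using *(1) by simp
  ultimately show ?case
    by simp
next
  case (below_one a b s t)
  obtain s1 t1 where *: "s' = s1 - t1" "has_p_integral p g 0 b s1" "has_p_integral p g 0 a t1"
    using below_one(1-3) by (elim has_p_integral_from_below_oneD[OF below_one(8)]) auto
  from has_p_integral.below_one[OF below_one(1-3) below_one(6)[OF *(2)] below_one(7)[OF *(3)]]
  moreover have "(s - s1) - (t - t1) = (s - t) - s'"
    using *(1) by simp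
  ultimately show ?case
    by simp
next
  case (across_one a b s t)
  obtain s1 t1 where *: "s' = s1 - t1" "has_p_integral p g 0 b s1" "has_p_integral p g 0 a t1"
    using across_one(1-3) by (elim has_p_integral_from_below_oneD[OF across_one(8)]) auto
  from has_p_integral.across_one[OF across_one(1-3) across_one(6)[OF *(2)] across_one(7)[OF *(3)]]
  moreover have "(s - s1) - (t - t1) = (s - t) - s'"
    using *(1) by simp
  ultimately show ?case
    by simp
qed

lemma has_p_integral_zero_fun:
  assumes "has_p_integral p f a b s" "f = (\<lambda>t. 0)"
  shows "s = 0"
  using assms by (induction rule: has_p_integral.induct) (auto simp: sums_iff)

text \<open>
  Two values of the same integral differ by a value of the integral of the zero function, so
  additivity already yields uniqueness.
\<close>

lemma has_p_integral_unique:
  assumes "has_p_integral p f a b s" "has_p_integral p f a b s'"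
  shows "s = s'"
  using has_p_integral_zero_fun[OF has_p_integral_diff[OF assms]] by simp

lemma has_p_integral_p_integral:
  "p_integrable p a b f \<Longrightarrow> has_p_integral p f a b (p_integral p a b f)"
  unfolding p_integrable_def p_integral_def by (rule theI') (blast intro: has_p_integral_unique)

section \<open>Telescoping bounds\<close>

lemma sums_ge_telescoped:
  fixes u w :: "nat \<Rightarrow> real"
  assumes "w sums s" "u \<longlonglongrightarrow> l" "\<And>j. u (Suc j) - u j \<le> w j"
  shows "l - u 0 \<le> s"
  by (rule sums_le[OF assms(3) telescope_sums[OF assms(2)] assms(1)])

lemma sums_ge_telescoped':
  fixes u w :: "nat \<Rightarrow> real"
  assumes "w sums s" "u \<longlonglongrightarrow> l" "\<And>j. u j - u (Suc j) \<le> w j"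
  shows "u 0 - l \<le> s"
  by (rule sums_le[OF assms(3) telescope_sums'[OF assms(2)] assms(1)])

text \<open>
  When both ends of an integral lie in \<open>(0,1)\<close>, or both above 1, it is a difference of two
  series.  The ends being in one orbit, the second series is a tail of the first, and only
  finitely many terms survive; so no limit of \<open>u\<close> enters, and the bound on \<open>w\<close>
  is needed only at the surviving indices.
\<close>

lemma sums_diff_tail_ge_telescoped:
  fixes u w :: "nat \<Rightarrow> real"
  assumes "w sums s" "(\<lambda>j. w (j + k)) sums s'" "\<And>j. j < k \<Longrightarrow> u j - u (Suc j) \<le> w j"
  shows "u 0 - u k \<le> s - s'"
proof -
  have "s' = s - (\<Sum>j<k. w j)"
    using sums_split_initial_segment[OF assms(1)] assms(2) by (rule sums_unique2[symmetric])
  moreover have "(\<Sum>j<k. u j - u (Suc j)) \<le> (\<Sum>j<k. w j)"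
    using assms(3) by (intro sum_mono) auto
  ultimately show ?thesis
    by (simp add: sum_lessThan_telescope')
qed

section \<open>The p-derivative\<close>

lemma p_deriv_le_below_one:
  assumes "0 < p" "p < 1" "0 < q" "q < 1" "p_deriv p I G q \<le> h q"
  shows "G (q powr p) - G q \<le> (q powr p - q) * h q"
proof -
  have "q < q powr p"
    using powr_less_mono'[of q p 1] assms by simp
  then show ?thesis
    using assms by (simp add: p_deriv_def field_simps)
qed

lemma p_deriv_le_above_one:
  assumes "0 < p" "p < 1" "1 < q" "p_deriv p I G q \<le> h q"
  shows "G q - G (q powr p) \<le> (q - q powr p) * h q"
proof -
  have "q powr p < q"
    using powr_less_mono[of p 1 q] assms by simp
  then show ?thesis
    using assms by (simp add: p_deriv_def field_simps)
qed

lemma p_deriv_diff: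
  "x \<noteq> 0 \<Longrightarrow> x \<noteq> 1 \<Longrightarrow> p_deriv p I (\<lambda>t. f t - g t) x = p_deriv p I f x - p_deriv p I g x"
  by (simp add: p_deriv_def diff_divide_distrib)

text \<open>
  In this form of the Leibniz rule it is the undifferentiated second factor that is shifted to
  \<open>x\<^sup>p\<close>, which matches the argument \<open>y (t\<^sup>p)\<close> of the Lagrangian.
\<close>

lemma p_deriv_mult:
  "x \<noteq> 0 \<Longrightarrow> x \<noteq> 1 \<Longrightarrow>
     p_deriv p I (\<lambda>t. f t * g t) x = p_deriv p I f x * g (x powr p) + f x * p_deriv p I g x"
  by (simp add: p_deriv_def add_divide_distrib[symmetric] algebra_simps)

section \<open>A one-sided fundamental theorem\<close>

text \<open>
  The points other than 0 and 1 at which the Euler-Lagrange equation is assumed.  They contain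
  every point at which the integral from \<open>a\<close> to \<open>b\<close> samples its integrand, up to terms
  that cancel.  The points 0 and 1 are removed because there the \<open>p\<close>-derivative is a limit and
  not a difference quotient; they are never sampled.
\<close>

definition p_sample_nodes :: "real \<Rightarrow> real \<Rightarrow> real \<Rightarrow> real set" where
  "p_sample_nodes p a b =
     (p_lattice p a b \<union> (if a = 0 then p_origin_nodes p b else {})) - {0, 1}"

text \<open>
  Apart from the point 0 an orbit stays on one side of 1, so \<open>a\<close> and \<open>b\<close> cannot lie strictly
  on different sides unless \<open>a = 0\<close>.  Two ends other than 0 and 1 are powers of one another: iterating
  \<open>x \<mapsto> x\<^sup>p\<close> moves points towards 1, so below 1 the larger end comes from the smaller one,
  and above 1 the smaller from the larger.
\<close>

lemma same_p_orbit_cases: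
  assumes p: "0 < p" "p < 1" and c: "0 \<le> c" and "a \<in> p_orbit p c" "b \<in> p_orbit p c" "a < b"
  obtains (zero_below) "a = 0" "0 < b" "b < 1"
    | (zero_one) "a = 0" "b = 1"
    | (zero_above) "a = 0" "1 < b"
    | (to_one) "0 < a" "a < 1" "b = 1"
    | (from_one) "a = 1" "1 < b"
    | (above) k where "1 < a" "1 < b" "a = p_node p b (int k)"
    | (below) k where "0 < a" "a < 1" "0 < b" "b < 1" "b = p_node p a (int k)"
proof -
  have nonneg: "0 \<le> a" "0 \<le> b"
    using assms(4,5) by (auto simp: p_orbit_def p_node_def)
  consider "a = 0" | "a = 1" | "0 < a" "b = 1"
    | m n where "0 < a" "a \<noteq> 1" "b \<noteq> 1" "a = p_node p c (int m)" "b = p_node p c (int n)"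
  proof (cases "a \<in> {0, 1} \<or> b = 1")
    case True
    then show ?thesis
      using that nonneg by fastforce
  next
    case False
    then obtain m n where "a = p_node p c (int m)" "b = p_node p c (int n)"
      using assms(4,5) nonneg \<open>a < b\<close> by (auto simp: p_orbit_def)
    then show ?thesis
      using False nonneg that(4) by auto
  qed
  then show ?thesis
  proof cases
    case 1
    then show ?thesis using \<open>a < b\<close> zero_below zero_one zero_above by linarith
  next
    case 2
    then show ?thesis using \<open>a < b\<close> from_one by simp
  next
    case 3
    then show ?thesis using \<open>a < b\<close> to_one by simp
  next
    case (4 m n)
    have shift: "p_node p c (int j) = p_node p (p_node p c (int i)) (int (j - i))" if "i \<le> j" for i j
      using that p by (simp add: p_node_p_node of_nat_diff)
    consider "c = 0" | "c = 1" | "0 < c" "c < 1" | "1 < c"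
      using c by linarith
    then show ?thesis
    proof cases
      case 1
      then show ?thesis using 4 by (simp add: p_node_def)
    next
      case 2
      then show ?thesis using 4 by (simp add: p_node_def)
    next
      case 3
      then have ab1: "a < 1" "0 < b" "b < 1"
        using 4 p_node_below_one[OF p(1)] by auto
      have "m \<le> n"
      proof (rule ccontr)
        assume "\<not> m \<le> n"
        then have "a = p_node p b (int (m - n))"
          using 4 shift[of n m] by simp
        then show False
          using p_node_ge_below_one[OF p ab1(2,3)] \<open>a < b\<close> by (metis not_le)
      qed
      then show ?thesis
        using 4 ab1 shift[of m n] below[of "n - m"] by simp
    next
      case above1: 4
      then have ab1: "1 < a" "1 < b"
        using 4 p_node_above_one[OF p(1)] by auto
      have "n \<le> m"
      proof (rule ccontr)
        assume "\<not> n \<le> m"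
        then have "b = p_node p a (int (n - m))"
          using 4 shift[of m n] by simp
        then show False
          using p_node_le_above_one[OF p ab1(1)] \<open>a < b\<close> by (metis not_le)
      qed
      then show ?thesis
        using 4 ab1 shift[of n m] above[of "m - n"] by simp
    qed
  qed
qed

lemma p_node_below_one_mem:
  assumes "0 < p" "is_interval I" "0 \<in> I" "1 \<in> I" "0 < x" "x < 1"
  shows "p_node p x j \<in> I"
  using p_node_below_one[of p x j] assms mem_is_interval_1_I[of I 0 1 "p_node p x j"] by simp

lemma p_node_above_one_mem:
  assumes "0 < p" "p < 1" "is_interval I" "1 \<in> I" "x \<in> I" "1 < x"
  shows "p_node p x (int j) \<in> I"
  using p_node_above_one[of p x "int j"] p_node_le_above_one[of p x j] assms
    mem_is_interval_1_I[of I 1 x "p_node p x (int j)"] by simp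

lemma p_sample_nodes_subset:
  assumes p: "0 < p" "p < 1" and I: "is_interval I" "I \<subseteq> {0..}" "0 \<in> I" "1 \<in> I"
    and ab: "a \<in> I" "b \<in> I" "a < b"
  shows "p_sample_nodes p a b \<subseteq> I"
proof -
  have node: "p_node p x (int j) \<in> I" if "x \<in> I" for x j
  proof -
    have "0 \<le> x"
      using that I(2) by auto
    then consider "x = 0" | "x = 1" | "0 < x" "x < 1" | "1 < x"
      by linarith
    then show ?thesis
    proof cases
      case 3
      then show ?thesis
        using p_node_below_one_mem[OF p(1) I(1,3,4)] by simp
    next
      case 4
      then show ?thesis
        using p_node_above_one_mem[OF p I(1,4) that] by simp
    qed (use I in \<open>auto simp: p_node_def\<close>)
  qed
  have origin: "p_origin_nodes p b \<subseteq> I" if "0 < b"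
  proof -
    note p_node_below_one_mem[OF p(1) I(1,3,4)]
    then show ?thesis
      using that p by (auto simp: p_origin_nodes_def)
  qed
  have "0 < b" if "a = 0"
    using that ab(3) by simp
  then have "p_sample_nodes p a b \<subseteq> p_orbit p a \<union> p_orbit p b \<union> (if 0 < b then p_origin_nodes p b else {})"
    by (auto simp: p_sample_nodes_def p_lattice_def)
  moreover have "p_orbit p a \<subseteq> I" "p_orbit p b \<subseteq> I"
    using node ab(1,2) I(3,4) by (auto simp: p_orbit_def)
  ultimately show ?thesis
    using origin by (cases "0 < b") auto
qed

text \<open>
  The integral is composed of three kinds of series: from a point down to 0, from a point
  up to 1, and from a point above 1 down to 1.  In each of them the terms dominate increments
  of \<open>G\<close> along a sequence of nodes that converges to 0 or 1, where \<open>G\<close> is continuous.  For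
  two positive ends strictly on the same side of 1, two series of one kind are subtracted and
  leave a finite sum over the nodes between the ends.
\<close>

lemma p_integral_ge_of_p_deriv_le:
  assumes p: "0 < p" "p < 1" and I: "is_interval I" "I \<subseteq> {0..}" "0 \<in> I" "1 \<in> I"
    and ab: "a \<in> I" "b \<in> I" "a < b"
    and c: "0 \<le> c" "a \<in> p_orbit p c" "b \<in> p_orbit p c"
    and h: "has_p_integral p h a b s"
    and G: "continuous (at 0 within I) G" "continuous (at 1 within I) G"
    and le: "\<And>q. q \<in> p_sample_nodes p a b \<Longrightarrow> p_deriv p I G q \<le> h q"
  shows "G b - G a \<le> s"
proof -
  have lim: "(\<lambda>n. G (z n)) \<longlonglongrightarrow> G l"
    if "z \<longlonglongrightarrow> l" "\<And>n. z n \<in> I" "continuous (at l within I) G" for z :: "nat \<Rightarrow> real" and l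
    using that by (auto simp: continuous_within_sequentially o_def)
  have minus_int_Suc: "- int (Suc j) = - int j - 1" for j
    by simp
  note below_in_I = p_node_below_one_mem[OF p(1) I(1,3,4)]
  note above_in_I = p_node_above_one_mem[OF p I(1,4)]
  have step_below: "G (p_node p x (j + 1)) - G (p_node p x j)
       \<le> (p_node p x (j + 1) - p_node p x j) * h (p_node p x j)"
    if "0 < x" "x < 1" "p_node p x j \<in> p_sample_nodes p a b" for x j
    using p_deriv_le_below_one[where q = "p_node p x j" and G = G and h = h, OF p]
      p_node_below_one[OF p(1) that(1,2), of j] le[OF that(3)]
    by (simp add: p_node_succ[OF p(1)])
  have step_above: "G (p_node p x j) - G (p_node p x (j + 1))
       \<le> (p_node p x j - p_node p x (j + 1)) * h (p_node p x j)"
    if "1 < x" "p_node p x j \<in> p_sample_nodes p a b" for x j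
    using p_deriv_le_above_one[where q = "p_node p x j" and G = G and h = h, OF p]
      p_node_above_one[OF p(1) that(1), of j] le[OF that(2)]
    by (simp add: p_node_succ[OF p(1)])
  have orbit_below: "p_node p x (int j) \<in> p_sample_nodes p a b"
    if "0 < x" "x < 1" "x = a \<or> x = b" for x j
    using that p_node_below_one[OF p(1) that(1,2), of "int j"]
    by (auto simp: p_sample_nodes_def p_lattice_def p_orbit_def)
  have orbit_above: "p_node p x (int j) \<in> p_sample_nodes p a b"
    if "1 < x" "x = a \<or> x = b" for x j
    using that p_node_above_one[OF p(1) that(1), of "int j"]
    by (auto simp: p_sample_nodes_def p_lattice_def p_orbit_def)
  have down_to_zero: "G x - G 0 \<le> s"
    if x: "0 < x" "x < 1"
      and s: "(\<lambda>j::nat. (p_node p x (- int j) - p_node p x (- int j - 1)) * h (p_node p x (- int j - 1)))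
               sums s"
      and nodes: "\<And>j::nat. p_node p x (- int j - 1) \<in> p_sample_nodes p a b" for x s
  proof -
    have "G (p_node p x (- int 0)) - G 0 \<le> s"
    proof (rule sums_ge_telescoped'[OF s])
      show "(\<lambda>j. G (p_node p x (- int j))) \<longlonglongrightarrow> G 0"
        by (rule lim[OF p_node_tendsto_zero[OF p x] below_in_I[OF x] G(1)])
      show "G (p_node p x (- int j)) - G (p_node p x (- int (Suc j)))
          \<le> (p_node p x (- int j) - p_node p x (- int j - 1)) * h (p_node p x (- int j - 1))" for j
        unfolding minus_int_Suc using step_below[OF x nodes[of j]] by simp
    qed
    then show ?thesis
      using x by (simp add: p_node_0)
  qed
  have up_to_one: "G 1 - G x \<le> s"
    if x: "0 < x" "x < 1"
      and s: "(\<lambda>j::nat. (p_node p x (int j + 1) - p_node p x (int j)) * h (p_node p x (int j))) sums s"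
      and nodes: "\<And>j::nat. p_node p x (int j) \<in> p_sample_nodes p a b" for x s
  proof -
    have "G 1 - G (p_node p x (int 0)) \<le> s"
    proof (rule sums_ge_telescoped[OF s])
      show "(\<lambda>j. G (p_node p x (int j))) \<longlonglongrightarrow> G 1"
        by (rule lim[OF p_node_tendsto_one[OF p x(1)] below_in_I[OF x] G(2)])
      show "G (p_node p x (int (Suc j))) - G (p_node p x (int j))
          \<le> (p_node p x (int j + 1) - p_node p x (int j)) * h (p_node p x (int j))" for j
        using step_below[OF x nodes[of j]] by (simp add: add.commute)
    qed
    then show ?thesis
      using x by (simp add: p_node_0)
  qed
  have zero_to_one: "G 1 - G 0 \<le> s" if "has_p_integral p h 0 1 s" "a = 0" "1 \<le> b" for s
  proof -
    from that(1) obtain s1 s2 where s: "s = s1 + s2"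
      "(\<lambda>j::nat. (p_node p p (int j + 1) - p_node p p (int j)) * h (p_node p p (int j))) sums s1"
      "(\<lambda>j::nat. (p_node p p (- int j) - p_node p p (- int j - 1)) * h (p_node p p (- int j - 1)))
          sums s2"
      by (rule has_p_integral_zero_oneD)
    have "p_node p p j \<in> p_sample_nodes p a b" for j
      using that p_node_below_one[OF p(1) p, of j]
      by (auto simp: p_sample_nodes_def p_origin_nodes_def)
    then show ?thesis
      using up_to_one[OF p s(2)] down_to_zero[OF p s(3)] s(1) by fastforce
  qed
  have down_to_one: "G b - G 1 \<le> s" if "has_p_integral p h 1 b s" "1 < b" for s
  proof -
    have "G (p_node p b (int 0)) - G 1 \<le> s"
    proof (rule sums_ge_telescoped'[OF has_p_integral_from_oneD[OF that(1)]])
      show "(\<lambda>j. G (p_node p b (int j))) \<longlonglongrightarrow> G 1"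
        using that(2) by (intro lim p_node_tendsto_one[OF p] above_in_I ab(2) G(2)) auto
      show "G (p_node p b (int j)) - G (p_node p b (int (Suc j)))
          \<le> (p_node p b (int j) - p_node p b (int j + 1)) * h (p_node p b (int j))" for j
        using step_above[OF that(2) orbit_above[OF that(2), of j]] by (simp add: add.commute)
    qed
    then show ?thesis
      using that by (simp add: p_node_0)
  qed
  from p c(1,2,3) ab(3) show ?thesis
  proof (cases rule: same_p_orbit_cases)
    case zero_below
    have "p_node p b (- int j - 1) \<in> p_sample_nodes p a b" for j
      using zero_below p_node_below_one[OF p(1) zero_below(2,3), of "- int j - 1"]
      by (auto simp: p_sample_nodes_def p_origin_nodes_def)
    then show ?thesis
      using zero_below h down_to_zero has_p_integral_zero_below_oneD by blast
  next
    case zero_one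
    then show ?thesis
      using h zero_to_one by simp
  next
    case zero_above
    obtain s1 s2 where "s = s1 + s2" "has_p_integral p h 0 1 s1" "has_p_integral p h 1 b s2"
      using zero_above h has_p_integral_zero_above_oneD by blast
    then show ?thesis
      using zero_to_one[of s1] down_to_one[of s2] zero_above by simp
  next
    case to_one
    then show ?thesis
      using up_to_one[OF to_one(1,2)] has_p_integral_to_oneD h orbit_below by blast
  next
    case from_one
    then show ?thesis
      using down_to_one h by simp
  next
    case (above k)
    obtain s1 s2 where s: "s = s1 - s2" "has_p_integral p h 1 b s1" "has_p_integral p h 1 a s2"
      using above h has_p_integral_above_oneD by blast
    define w where "w j = (p_node p b (int j) - p_node p b (int j + 1)) * h (p_node p b (int j))" for j
    have "G (p_node p b (int 0)) - G (p_node p b (int k)) \<le> s1 - s2"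
    proof (rule sums_diff_tail_ge_telescoped[where w = w])
      show "w sums s1"
        using has_p_integral_from_oneD[OF s(2)] by (simp add: w_def[abs_def])
      show "(\<lambda>j. w (j + k)) sums s2"
        using has_p_integral_from_oneD[OF s(3)] p
        by (simp add: w_def[abs_def] above(3) p_node_p_node add_ac)
      show "G (p_node p b (int j)) - G (p_node p b (int (Suc j))) \<le> w j" for j
        using step_above[OF above(2) orbit_above[OF above(2), of j]]
        by (simp add: w_def add.commute)
    qed
    then show ?thesis
      using above s(1) by (simp add: p_node_0)
  next
    case (below k)
    obtain s1 s2 where s: "s = s1 - s2" "has_p_integral p h 0 b s1" "has_p_integral p h 0 a s2"
      using below h has_p_integral_from_below_oneD by (metis less_irrefl)
    define w where "w j = (p_node p b (- int j) - p_node p b (- int j - 1)) * h (p_node p b (- int j - 1))"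
      for j
    have node_b: "p_node p b i = p_node p a (int k + i)" for i
      using p below(5) by (simp add: p_node_p_node)
    have index_shift: "int k + - int (j + k) = - int j" "int k + (- int (j + k) - 1) = - int j - 1" for j
      by simp_all
    have "G (p_node p b (- int 0)) - G (p_node p b (- int k)) \<le> s1 - s2"
    proof (rule sums_diff_tail_ge_telescoped[where w = w])
      show "w sums s1"
        using has_p_integral_zero_below_oneD[OF s(2) below(4)] by (simp add: w_def[abs_def])
      show "(\<lambda>j. w (j + k)) sums s2"
        unfolding w_def node_b index_shift
        by (rule has_p_integral_zero_below_oneD[OF s(3) below(2)])
      show "G (p_node p b (- int j)) - G (p_node p b (- int (Suc j))) \<le> w j" if "j < k" for j
      proof -
        \<comment> \<open>Before the tail starts, the nodes of the series have not yet descended below \<open>a\<close>.\<close>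
        have "p_node p b (- int j - 1) = p_node p a (int (k - Suc j))"
          using that by (simp add: node_b of_nat_diff algebra_simps)
        then have "p_node p b (- int j - 1) \<in> p_sample_nodes p a b"
          using orbit_below below by simp
        from step_below[OF below(3,4) this] show ?thesis
          unfolding minus_int_Suc by (simp add: w_def)
      qed
    qed
    then show ?thesis
      using below(1,3) s(1) by (simp add: p_node_0 node_b flip: below(5))
  qed
qed

section \<open>Optimality of extremals\<close>

text \<open>
  Both halves of the theorem are instances, with \<open>h\<close> a difference of the two
  integrands: in the convex case \<open>z\<close> is the extremal, in the concave case \<open>y\<close> is.  This is
  why \<open>f\<close> and \<open>g\<close> are kept independent of \<open>y\<close> and \<open>z\<close>.
\<close>

lemma p_integral_variation_nonneg:
  assumes p: "0 < p" "p < 1" and I: "is_interval I" "I \<subseteq> {0..}" "0 \<in> I" "1 \<in> I"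
    and ab: "a \<in> I" "b \<in> I" "a < b"
    and c: "0 \<le> c" "a \<in> p_orbit p c" "b \<in> p_orbit p c"
    and y: "y \<in> p_admissible p I a b \<alpha> \<beta>" and z: "z \<in> p_admissible p I a b \<alpha> \<beta>"
    and g: "g \<in> p_space p I a b"
    and EL: "\<And>q. q \<in> p_sample_nodes p a b \<Longrightarrow> f q = p_deriv p I g q"
    and h: "has_p_integral p h a b s"
    and le: "\<And>q. q \<in> p_sample_nodes p a b \<Longrightarrow>
      f q * (y (q powr p) - z (q powr p)) + g q * (p_deriv p I y q - p_deriv p I z q) \<le> h q"
  shows "0 \<le> s"
proof -
  define G where "G t = g t * (y t - z t)" for t
  have "G b - G a \<le> s"
  proof (rule p_integral_ge_of_p_deriv_le[OF p I ab c h])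
    show "continuous (at 0 within I) G" "continuous (at 1 within I) G"
      using y z g unfolding G_def[abs_def] p_admissible_def p_space_def
      by (auto intro!: continuous_intros)
  next
    fix q assume q: "q \<in> p_sample_nodes p a b"
    then have "q \<noteq> 0" "q \<noteq> 1"
      by (auto simp: p_sample_nodes_def)
    then show "p_deriv p I G q \<le> h q"
      using le[OF q] EL[OF q] by (simp add: G_def[abs_def] p_deriv_mult p_deriv_diff)
  qed
  moreover have "G a = 0" "G b = 0"
    using y z by (auto simp: G_def p_admissible_def)
  ultimately show ?thesis
    by simp
qed

theorem theorem5:
  fixes p a b c \<alpha> \<beta> :: real
    and I :: "real set"
    and L :: "real \<Rightarrow> real \<Rightarrow> real \<Rightarrow> real"
    and ystar :: "real \<Rightarrow> real"
  assumes p: "0 < p" "p < 1"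
    and I: "is_interval I" "I \<subseteq> {0..}" "0 \<in> I" "1 \<in> I"
    and ab: "a \<in> I" "b \<in> I" "a < b"
    and c: "c \<in> I" "a \<in> p_orbit p c" "b \<in> p_orbit p c"
    and L_C1: "\<And>t. t \<in> I \<Longrightarrow> C1_in_uv L t"
    and L_cont: "\<And>y. y \<in> p_admissible p I a b \<alpha> \<beta>
                   \<Longrightarrow> continuous (at 1 within I) (p_along p I L y)"
    and L_partials: "\<And>y. y \<in> p_admissible p I a b \<alpha> \<beta>
                   \<Longrightarrow> p_along p I (partial2 L) y \<in> p_space p I a b
                     \<and> p_along p I (partial3 L) y \<in> p_space p I a b"
    and ystar: "ystar \<in> p_admissible p I a b \<alpha> \<beta>"
    and EL: "\<And>t. t \<in> p_lattice p a b \<Longrightarrow> p_euler_lagrange_at p I L ystar t"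
    and EL_origin: "\<And>t. a = 0 \<Longrightarrow> t \<in> p_origin_nodes p b \<Longrightarrow> p_euler_lagrange_at p I L ystar t"
    and ystar_integrable: "p_integrable p a b (p_along p I L ystar)"
  shows "(jointly_convex I L \<longrightarrow>
            (\<forall>y \<in> p_admissible p I a b \<alpha> \<beta>. p_integrable p a b (p_along p I L y) \<longrightarrow>
               p_functional p I a b L ystar \<le> p_functional p I a b L y)) \<and>
         (jointly_concave I L \<longrightarrow>
            (\<forall>y \<in> p_admissible p I a b \<alpha> \<beta>. p_integrable p a b (p_along p I L y) \<longrightarrow>
               p_functional p I a b L ystar \<ge> p_functional p I a b L y))"
proof -
  have c0: "0 \<le> c"
    using c(1) I(2) by auto
  have nodes_I: "q \<in> I" if "q \<in> p_sample_nodes p a b" for q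
    using that p_sample_nodes_subset[OF p I ab] by auto
  have EL': "p_along p I (partial2 L) ystar q = p_deriv p I (p_along p I (partial3 L) ystar) q"
    if "q \<in> p_sample_nodes p a b" for q
    using that EL[of q] EL_origin[of q]
    by (auto simp: p_sample_nodes_def p_euler_lagrange_at_def split: if_splits)
  have g: "p_along p I (partial3 L) ystar \<in> p_space p I a b"
    using L_partials[OF ystar] by simp
  note variation = p_integral_variation_nonneg[OF p I ab c0 c(2,3) _ _ g EL']
  note int_star = has_p_integral_p_integral[OF ystar_integrable]
  show ?thesis
    unfolding p_functional_def
  proof (intro conjI impI ballI)
    fix y assume L: "jointly_convex I L" and y: "y \<in> p_admissible p I a b \<alpha> \<beta>"
      and "p_integrable p a b (p_along p I L y)"
    note int_y = has_p_integral_p_integral[OF this(3)]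
    have "0 \<le> p_integral p a b (p_along p I L y) - p_integral p a b (p_along p I L ystar)"
    proof (rule variation[OF y ystar _ has_p_integral_diff[OF int_y int_star]])
      fix q assume "q \<in> p_sample_nodes p a b"
      from nodes_I[OF this] L
      have "partial2 L q u v * du + partial3 L q u v * dv \<le> L q (u + du) (v + dv) - L q u v"
        for u v du dv
        by (auto simp: jointly_convex_def)
      from this[where u = "ystar (q powr p)" and du = "y (q powr p) - ystar (q powr p)"
          and v = "p_deriv p I ystar q" and dv = "p_deriv p I y q - p_deriv p I ystar q"]
      show "p_along p I (partial2 L) ystar q * (y (q powr p) - ystar (q powr p)) +
          p_along p I (partial3 L) ystar q * (p_deriv p I y q - p_deriv p I ystar q)
          \<le> p_along p I L y q - p_along p I L ystar q"
        by (simp add: p_along_def)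
    qed
    then show "p_integral p a b (p_along p I L ystar) \<le> p_integral p a b (p_along p I L y)"
      by simp
  next
    fix y assume L: "jointly_concave I L" and y: "y \<in> p_admissible p I a b \<alpha> \<beta>"
      and "p_integrable p a b (p_along p I L y)"
    note int_y = has_p_integral_p_integral[OF this(3)]
    have "0 \<le> p_integral p a b (p_along p I L ystar) - p_integral p a b (p_along p I L y)"
    proof (rule variation[OF ystar y _ has_p_integral_diff[OF int_star int_y]])
      fix q assume "q \<in> p_sample_nodes p a b"
      from nodes_I[OF this] L
      have "L q (u + du) (v + dv) - L q u v \<le> partial2 L q u v * du + partial3 L q u v * dv"
        for u v du dv
        by (auto simp: jointly_concave_def)
      from this[where u = "ystar (q powr p)" and du = "y (q powr p) - ystar (q powr p)"
          and v = "p_deriv p I ystar q" and dv = "p_deriv p I y q - p_deriv p I ystar q"]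
      show "p_along p I (partial2 L) ystar q * (ystar (q powr p) - y (q powr p)) +
          p_along p I (partial3 L) ystar q * (p_deriv p I ystar q - p_deriv p I y q)
          \<le> p_along p I L ystar q - p_along p I L y q"
        by (simp add: p_along_def algebra_simps)
    qed
    then show "p_integral p a b (p_along p I L ystar) \<ge> p_integral p a b (p_along p I L y)"
      by simp
  qed
qed

end
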